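(* Let $K$ be a compact topological space and let $k\ge 2$ be an integer. If there exists a bi-Lipschitz embedding of the metric space $\Delta_{\le k}(\mathbb{N})$ into $C(K)$ with distortion strictly less than $\frac{k}{k-1}$, then the Cantor-Bendixson derivative $K^{(k-1)}$ of order $k-1$ is infinite.
   Context: $C(K)$ is the Banach space of continuous functions on $K$ with the supremum norm $\|\cdot\|_\infty$, viewed as a metric space with its norm distance. $\Delta_{\le k}(\mathbb{N})$ is the metric space whose points are all subsets of $\mathbb{N}$ with at most $k$ elements (including the empty set), equipped with the symmetric difference metric $d_\Delta(\sigma,\tau)=|\sigma\bigtriangleup\tau|$ (cardinality of the symmetric difference). For metric spaces $M,N$, the distortion of a map $f\colon M\to N$ is $$\mathrm{dist}(f)=\sup_{x\neq y\in M}\frac{d_N(f(x),f(y))}{d_M(x,y)}\cdot\sup_{x\neq y\in M}\frac{d_M(x,y)}{d_N(f(x),f(y))},$$ and $f$ is a bi-Lipschitz embedding if $\mathrm{dist}(f)<\infty$. Cantor-Bendixson derivatives: $K'$ is the set of points of $K$ that are not isolated in $K$; $K^{(0)}=K$ and $K^{(n+1)}=(K^{(n)})'$, where $K^{(n)}$ carries the subspace topology. *)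

theory Defs
  imports "HOL-Analysis.Analysis"
begin

text \<open>
  A non-injective map has infinite distortion. This case has to be separated because
  \<open>0 * \<infinity> = 0\<close> in \<^typ>\<open>ennreal\<close>, so the bare product of suprema would assign distortion \<open>0\<close>
  to a constant map. For injective maps all the quotients below have nonzero denominators.
\<close>

definition distortion :: "'a metric \<Rightarrow> 'b metric \<Rightarrow> ('a \<Rightarrow> 'b) \<Rightarrow> ennreal" where
  "distortion M N f =
     (if inj_on f (mspace M) then
        (SUP (x, y) \<in> {(x, y). x \<in> mspace M \<and> y \<in> mspace M \<and> x \<noteq> y}.
            ennreal (mdist N (f x) (f y) / mdist M x y)) *
        (SUP (x, y) \<in> {(x, y). x \<in> mspace M \<and> y \<in> mspace M \<and> x \<noteq> y}.
            ennreal (mdist M x y / mdist N (f x) (f y)))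
      else \<infinity>)"

definition bi_lipschitz_embedding :: "'a metric \<Rightarrow> 'b metric \<Rightarrow> ('a \<Rightarrow> 'b) \<Rightarrow> bool" where
  "bi_lipschitz_embedding M N f \<longleftrightarrow> f \<in> mspace M \<rightarrow> mspace N \<and> distortion M N f < \<infinity>"

text \<open>The conjunct \<open>finite \<sigma>\<close> is needed since \<^const>\<open>card\<close> vanishes on infinite sets.\<close>

definition Delta_points :: "nat \<Rightarrow> nat set set" where
  "Delta_points k = {\<sigma>. finite \<sigma> \<and> card \<sigma> \<le> k}"

definition Delta_dist :: "nat set \<Rightarrow> nat set \<Rightarrow> real" where
  "Delta_dist \<sigma> \<tau> = real (card (sym_diff \<sigma> \<tau>))"

text \<open>
  \<^term>\<open>Delta_dist\<close> is not a metric on all of \<^typ>\<open>nat set\<close>; \<open>Metric_space_Delta\<close> is what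
  makes the following use of \<^const>\<open>metric\<close> meaningful.
\<close>

definition Delta :: "nat \<Rightarrow> nat set metric" where
  "Delta k = metric (Delta_points k, Delta_dist)"

lemma Metric_space_Delta: "Metric_space (Delta_points k) Delta_dist"
proof
  fix \<sigma> \<tau> \<upsilon> :: "nat set"
  show "0 \<le> Delta_dist \<sigma> \<tau>"
    by (simp add: Delta_dist_def)
  show "Delta_dist \<sigma> \<tau> = Delta_dist \<tau> \<sigma>"
    by (simp add: Delta_dist_def Un_commute)
  show "Delta_dist \<sigma> \<tau> = 0 \<longleftrightarrow> \<sigma> = \<tau>" if "\<sigma> \<in> Delta_points k" "\<tau> \<in> Delta_points k"
    using that by (auto simp: Delta_dist_def Delta_points_def)
  show "Delta_dist \<sigma> \<upsilon> \<le> Delta_dist \<sigma> \<tau> + Delta_dist \<tau> \<upsilon>"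
    if "\<sigma> \<in> Delta_points k" "\<tau> \<in> Delta_points k" "\<upsilon> \<in> Delta_points k"
  proof -
    have "card (sym_diff \<sigma> \<upsilon>) \<le> card (sym_diff \<sigma> \<tau> \<union> sym_diff \<tau> \<upsilon>)"
      using that by (intro card_mono) (auto simp: Delta_points_def)
    also have "\<dots> \<le> card (sym_diff \<sigma> \<tau>) + card (sym_diff \<tau> \<upsilon>)"
      by (rule card_Un_le)
    finally show ?thesis
      by (simp add: Delta_dist_def)
  qed
qed

lemma mspace_Delta [simp]: "mspace (Delta k) = Delta_points k"
  by (simp add: Delta_def Metric_space.mspace_metric[OF Metric_space_Delta])

lemma mdist_Delta [simp]: "mdist (Delta k) = Delta_dist"
  by (simp add: Delta_def Metric_space.mdist_metric[OF Metric_space_Delta])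

text \<open>
  Real-valued continuous functions with the supremum distance. The functions in
  \<^const>\<open>cfunspace\<close> are required to be bounded, which is automatic when \<open>K\<close> is compact,
  and they are extensional outside \<open>topspace K\<close>.
\<close>

definition C_space :: "'a topology \<Rightarrow> ('a \<Rightarrow> real) metric" where
  "C_space K = cfunspace K euclidean_metric"

primrec cantor_bendixson :: "'a topology \<Rightarrow> nat \<Rightarrow> 'a set" where
  "cantor_bendixson K 0 = topspace K"
| "cantor_bendixson K (Suc n) =
     {x \<in> cantor_bendixson K n.
        \<not> openin (subtopology K (cantor_bendixson K n)) {x}}"

end

theory Submission
  imports Defs
begin

text \<open>
  Suppose that \<open>f\<close> satisfies \<open>d \<le> b \<parallel>f \<sigma> - f \<tau>\<parallel>\<close> and \<open>\<parallel>f \<sigma> - f \<tau>\<parallel> \<le> a d\<close> with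
  \<open>a b < k / (k - 1)\<close>. For disjoint \<open>\<sigma>\<close>, \<open>\<tau>\<close> with \<open>j\<close> elements each, there is a point \<open>x\<close> of
  \<open>K\<^sup>(\<^sup>k\<^sup>-\<^sup>j\<^sup>)\<close> with \<open>\<bar>f \<sigma> x - f \<tau> x\<bar> \<ge> 2 k / b - 2 (k - j) a\<close>. For \<open>j = k\<close> the norm
  of \<open>f \<sigma> - f \<tau>\<close> is attained. To pass from \<open>j + 1\<close> to \<open>j\<close>, take such points for all pairs
  \<open>\<sigma> \<union> {m}\<close>, \<open>\<tau> \<union> {n}\<close> with \<open>m \<noteq> n\<close>. By the upper Lipschitz bound they lie in the closed set
  described by \<open>\<sigma>\<close>, \<open>\<tau>\<close>, and they separate the functions \<open>f {m}\<close> and \<open>f {n}\<close> by at least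
  \<open>2 k / b - 2 (k - 1) a > 0\<close>. Finitely many points cannot separate infinitely many uniformly
  bounded functions, so the closed set is infinite and, by compactness, has an accumulation point.
  The same separation argument applied to the case \<open>j = 1\<close> shows that \<open>K\<^sup>(\<^sup>k\<^sup>-\<^sup>1\<^sup>)\<close> is infinite.
\<close>

section \<open>Cantor-Bendixson derivatives and accumulation points\<close>

lemma closedin_nonisolated:
  assumes "closedin X C"
  shows "closedin X {x \<in> C. \<not> openin (subtopology X C) {x}}"
proof -
  let ?I = "\<Union>{{x} | x. openin (subtopology X C) {x}}"
  have "openin (subtopology X C) ?I"
    by blast
  then have "closedin (subtopology X C) (topspace (subtopology X C) - ?I)"
    by blast
  moreover have "topspace (subtopology X C) - ?I = {x \<in> C. \<not> openin (subtopology X C) {x}}"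
    using closedin_subset[OF assms] by auto
  ultimately show ?thesis
    using assms closedin_trans_full by metis
qed

lemma closedin_cantor_bendixson: "closedin K (cantor_bendixson K n)"
  by (induction n) (auto intro: closedin_nonisolated)

text \<open>An accumulation point of the infinite set exists by compactness and stays in it by
  closedness. It is not isolated in the \<open>n\<close>-th derivative, since points of that
  derivative already accumulate there.\<close>

lemma cantor_bendixson_Suc_meets_infinite:
  assumes "compact_space K" "closedin K G" "infinite (cantor_bendixson K n \<inter> G)"
  shows "cantor_bendixson K (Suc n) \<inter> G \<noteq> {}"
proof -
  let ?C = "cantor_bendixson K n"
  have cl: "closedin K (?C \<inter> G)"
    using assms(2) closedin_cantor_bendixson by blast
  obtain x where x: "x \<in> K derived_set_of (?C \<inter> G)"
    using compact_space_imp_Bolzano_Weierstrass[OF assms(1,3)] closedin_subset[OF cl] by blast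
  then have mem: "x \<in> ?C \<inter> G"
    using cl by (auto simp: closedin_contains_derived_set)
  have "\<not> openin (subtopology K ?C) {x}"
  proof
    assume "openin (subtopology K ?C) {x}"
    then obtain T where T: "openin K T" "{x} = T \<inter> ?C"
      by (auto simp: openin_subtopology)
    then obtain y where "y \<noteq> x" "y \<in> ?C \<inter> G" "y \<in> T"
      using x by (auto simp: in_derived_set_of)
    then show False
      using T(2) by blast
  qed
  then show ?thesis
    using mem by auto
qed

section \<open>Separation of pointwise bounded families\<close>

text \<open>Pigeonhole: on a finite \<open>S\<close>, rounding the values to multiples of
  \<open>c\<close> leaves finitely many patterns, and two functions with the same pattern differ by
  less than \<open>c\<close> on all of \<open>S\<close>.\<close>

lemma infinite_if_separates_bounded:
  fixes h :: "'i \<Rightarrow> 'a \<Rightarrow> real"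
  assumes "infinite N" "c > 0"
    and bounded: "\<And>n x. n \<in> N \<Longrightarrow> x \<in> S \<Longrightarrow> \<bar>h n x\<bar> \<le> B x"
    and separates: "\<And>m n. m \<in> N \<Longrightarrow> n \<in> N \<Longrightarrow> m \<noteq> n \<Longrightarrow> \<exists>x\<in>S. \<bar>h m x - h n x\<bar> \<ge> c"
  shows "infinite S"
proof
  assume "finite S"
  define q where "q n = restrict (\<lambda>x. \<lfloor>h n x / c\<rfloor>) S" for n
  have "q ` N \<subseteq> PiE S (\<lambda>x. {\<lfloor>- B x / c\<rfloor>..\<lfloor>B x / c\<rfloor>})"
  proof (clarsimp simp: q_def)
    fix n x assume "n \<in> N" "x \<in> S"
    then have "- B x \<le> h n x" "h n x \<le> B x"
      using bounded[of n x] by linarith+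
    then have "- B x / c \<le> h n x / c" "h n x / c \<le> B x / c"
      using \<open>c > 0\<close> by (simp_all only: divide_right_mono less_imp_le)
    then show "\<lfloor>- (B x / c)\<rfloor> \<le> \<lfloor>h n x / c\<rfloor> \<and> \<lfloor>h n x / c\<rfloor> \<le> \<lfloor>B x / c\<rfloor>"
      by (simp add: floor_mono)
  qed
  then have "finite (q ` N)"
    using \<open>finite S\<close> by (meson finite_PiE finite_atLeastAtMost_int finite_subset)
  then have "\<not> inj_on q N"
    using \<open>infinite N\<close> finite_image_iff by blast
  then obtain m n where mn: "m \<in> N" "n \<in> N" "m \<noteq> n" "q m = q n"
    by (auto simp: inj_on_def)
  then obtain x where x: "x \<in> S" "\<bar>h m x - h n x\<bar> \<ge> c"
    using separates by blast
  have "\<lfloor>h m x / c\<rfloor> = \<lfloor>h n x / c\<rfloor>"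
    using fun_cong[OF mn(4), of x] x(1) by (simp add: q_def)
  then have "\<bar>h m x / c - h n x / c\<bar> < 1"
    by linarith
  then have "\<bar>h m x - h n x\<bar> < c"
    using \<open>c > 0\<close> by (simp flip: diff_divide_distrib add: abs_divide)
  with x(2) show False
    by simp
qed

section \<open>From distortion to real Lipschitz constants\<close>

lemma distortion_less_imp_bounds:
  fixes f :: "'a \<Rightarrow> 'b"
  assumes less: "distortion M N f < ennreal C"
    and maps: "f \<in> mspace M \<rightarrow> mspace N"
    and two: "p \<in> mspace M" "q \<in> mspace M" "p \<noteq> q"
  obtains a b where "a > 0" "b > 0" "a * b < C"
    "\<And>x y. x \<in> mspace M \<Longrightarrow> y \<in> mspace M \<Longrightarrow> mdist N (f x) (f y) \<le> a * mdist M x y"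
    "\<And>x y. x \<in> mspace M \<Longrightarrow> y \<in> mspace M \<Longrightarrow> mdist M x y \<le> b * mdist N (f x) (f y)"
proof -
  let ?P = "{(x, y). x \<in> mspace M \<and> y \<in> mspace M \<and> x \<noteq> y}"
  define A where "A = (SUP (x, y) \<in> ?P. ennreal (mdist N (f x) (f y) / mdist M x y))"
  define B where "B = (SUP (x, y) \<in> ?P. ennreal (mdist M x y / mdist N (f x) (f y)))"
  have inj: "inj_on f (mspace M)"
    using less by (auto simp: distortion_def split: if_splits)
  have AB: "A * B < ennreal C"
    using less inj by (simp add: distortion_def A_def B_def)
  have pos: "mdist M x y > 0" "mdist N (f x) (f y) > 0"
    if "x \<in> mspace M" "y \<in> mspace M" "x \<noteq> y" for x y
  proof -
    have "f x \<in> mspace N" "f y \<in> mspace N" "f x \<noteq> f y"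
      using that maps inj by (auto simp: inj_on_def)
    then show "mdist M x y > 0" "mdist N (f x) (f y) > 0"
      using that by (simp_all add: Metric_space.mdist_pos_eq[OF Metric_space_mspace_mdist])
  qed
  have upA: "ennreal (mdist N (f x) (f y) / mdist M x y) \<le> A"
    and upB: "ennreal (mdist M x y / mdist N (f x) (f y)) \<le> B"
    if "x \<in> mspace M" "y \<in> mspace M" "x \<noteq> y" for x y
    unfolding A_def B_def using that by (auto intro!: SUP_upper2[of "(x, y)"])
  \<comment> \<open>The two distinct points make both suprema positive. This excludes
    \<open>0 * top = 0\<close>, so a finite product forces both factors to be finite.\<close>
  have "A > 0" "B > 0"
    using upA[OF two] upB[OF two] pos[OF two]
    by (metis divide_pos_pos ennreal_less_zero_iff order_less_le_trans)+
  moreover have "A * B \<noteq> top"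
    using AB by auto
  ultimately have "A < top" "B < top"
    by (auto simp: ennreal_mult_eq_top_iff top.not_eq_extremum)
  with \<open>A > 0\<close> \<open>B > 0\<close> obtain a b where ab: "A = ennreal a" "B = ennreal b" "a > 0" "b > 0"
    using that[of "enn2real A" "enn2real B"] by (simp add: enn2real_positive_iff)
  have le: "mdist N (f x) (f y) \<le> a * mdist M x y" "mdist M x y \<le> b * mdist N (f x) (f y)"
    if "x \<in> mspace M" "y \<in> mspace M" for x y
  proof -
    have "mdist N (f x) (f y) \<le> a * mdist M x y \<and> mdist M x y \<le> b * mdist N (f x) (f y)"
    proof (cases "x = y")
      case True
      then show ?thesis
        using that funcset_mem[OF maps that(1)]
        by (simp add: Metric_space.mdist_zero[OF Metric_space_mspace_mdist])
    next
      case False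
      have "mdist N (f x) (f y) / mdist M x y \<le> a" "mdist M x y / mdist N (f x) (f y) \<le> b"
        using upA[OF that False] upB[OF that False] ab by simp_all
      then show ?thesis
        using pos[OF that False] by (simp add: divide_le_eq)
    qed
    then show "mdist N (f x) (f y) \<le> a * mdist M x y" "mdist M x y \<le> b * mdist N (f x) (f y)"
      by blast+
  qed
  have "a * b < C"
    using AB ab by (simp flip: ennreal_mult add: ennreal_less_iff)
  then show ?thesis
    using that[OF ab(3,4) _ le] by simp
qed

section \<open>Distances in C(K)\<close>

lemma continuous_map_C_space:
  "g \<in> mspace (C_space K) \<Longrightarrow> continuous_map K euclideanreal g"
  by (simp add: C_space_def)

lemma abs_diff_le_mdist_C_space:
  assumes "g \<in> mspace (C_space K)" "h \<in> mspace (C_space K)" "x \<in> topspace K"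
  shows "\<bar>g x - h x\<bar> \<le> mdist (C_space K) g h"
  using mdist_cfunspace_imp_mdist_le[of g K euclidean_metric h, OF _ _ order_refl] assms
  by (simp add: C_space_def dist_real_def)

lemma mdist_C_space_attained:
  assumes "compact_space K" "g \<in> mspace (C_space K)" "h \<in> mspace (C_space K)"
    and "mdist (C_space K) g h > 0"
  obtains x where "x \<in> topspace K" "mdist (C_space K) g h \<le> \<bar>g x - h x\<bar>"
proof -
  let ?u = "\<lambda>x. \<bar>g x - h x\<bar>"
  \<comment> \<open>Over an empty space every distance is at most 0.\<close>
  have "topspace K \<noteq> {}"
    using assms(4) mdist_cfunspace_le[of 0 K euclidean_metric g h] by (auto simp: C_space_def)
  have "continuous_map K euclideanreal ?u"
    using assms by (intro continuous_intros continuous_map_C_space)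
  then have "compact (?u ` topspace K)"
    using image_compactin[of K "topspace K" euclideanreal ?u] assms(1)
    by (simp add: compact_space_def)
  then obtain x where x: "x \<in> topspace K" "\<And>y. y \<in> topspace K \<Longrightarrow> ?u y \<le> ?u x"
    using compact_attains_sup[of "?u ` topspace K"] \<open>topspace K \<noteq> {}\<close> by auto
  then have "mdist (C_space K) g h \<le> ?u x"
    unfolding C_space_def by (intro mdist_cfunspace_le) (auto simp: dist_real_def)
  with x(1) that show ?thesis
    by blast
qed

section \<open>The induction along the derivatives\<close>

locale low_distortion_embedding =
  fixes K :: "'a topology" and k :: nat and f :: "nat set \<Rightarrow> 'a \<Rightarrow> real" and a b :: real
  assumes compact: "compact_space K"
    and k_pos: "k \<ge> 1"
    and maps: "f \<in> Delta_points k \<rightarrow> mspace (C_space K)"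
    and a_nonneg: "a \<ge> 0"
    and b_pos: "b > 0"
    and ab: "real (k - 1) * (a * b) < real k"
    and upper: "\<sigma> \<in> Delta_points k \<Longrightarrow> \<tau> \<in> Delta_points k \<Longrightarrow>
      mdist (C_space K) (f \<sigma>) (f \<tau>) \<le> a * Delta_dist \<sigma> \<tau>"
    and lower: "\<sigma> \<in> Delta_points k \<Longrightarrow> \<tau> \<in> Delta_points k \<Longrightarrow>
      Delta_dist \<sigma> \<tau> \<le> b * mdist (C_space K) (f \<sigma>) (f \<tau>)"
begin

text \<open>Disjoint \<open>k\<close>-element sets have distance \<open>2 * k\<close>, so their
  images are at least \<open>2 * k / b\<close> apart; each removal of one element from both sets
  costs at most \<open>2 * a\<close>.\<close>

definition gap :: "nat \<Rightarrow> real" where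
  "gap j = 2 * real k / b - 2 * (real k - real j) * a"

text \<open>Meant for sets of equal size, hence only \<open>card \<sigma>\<close> enters.\<close>

definition far :: "nat set \<Rightarrow> nat set \<Rightarrow> 'a set" where
  "far \<sigma> \<tau> = {x \<in> topspace K. gap (card \<sigma>) \<le> \<bar>f \<sigma> x - f \<tau> x\<bar>}"

lemma far_subset: "far \<sigma> \<tau> \<subseteq> topspace K"
  by (auto simp: far_def)

lemma gap_Suc: "gap (Suc j) = gap j + 2 * a"
  by (simp add: gap_def algebra_simps)

text \<open>This is exactly the distortion bound \<open>ab\<close>, divided by
  \<open>b\<close>.\<close>

lemma gap_1_pos: "gap 1 > 0"
proof -
  have "(real k - 1) * a < real k / b"
    using ab b_pos k_pos by (simp add: pos_less_divide_eq of_nat_diff mult.assoc)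
  moreover have "gap 1 = 2 * (real k / b - (real k - 1) * a)"
    by (simp add: gap_def algebra_simps)
  ultimately show ?thesis
    by simp
qed

lemma abs_diff_le:
  assumes "\<sigma> \<in> Delta_points k" "\<tau> \<in> Delta_points k" "x \<in> topspace K" "card (sym_diff \<sigma> \<tau>) \<le> n"
  shows "\<bar>f \<sigma> x - f \<tau> x\<bar> \<le> real n * a"
proof -
  have "\<bar>f \<sigma> x - f \<tau> x\<bar> \<le> a * Delta_dist \<sigma> \<tau>"
    using upper[OF assms(1,2)] abs_diff_le_mdist_C_space[of "f \<sigma>" K "f \<tau>" x] maps assms
    by fastforce
  also have "\<dots> \<le> a * real n"
    unfolding Delta_dist_def using assms(4) a_nonneg by (intro mult_left_mono) auto
  finally show ?thesis
    by (simp add: mult.commute)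
qed

lemma closedin_far:
  assumes "\<sigma> \<in> Delta_points k" "\<tau> \<in> Delta_points k"
  shows "closedin K (far \<sigma> \<tau>)"
proof -
  have "continuous_map K euclideanreal (\<lambda>x. \<bar>f \<sigma> x - f \<tau> x\<bar>)"
    using assms maps by (intro continuous_intros continuous_map_C_space) auto
  then have "closedin K {x \<in> topspace K. \<bar>f \<sigma> x - f \<tau> x\<bar> \<in> {gap (card \<sigma>)..}}"
    by (rule closedin_continuous_map_preimage) simp
  then show ?thesis
    by (simp add: far_def)
qed

text \<open>All singletons have distance 1 from the empty set, so the functions \<open>f {n}\<close>
  are within \<open>a\<close> of \<open>f {}\<close>, which bounds them independently of
  \<open>n\<close>.\<close>

lemma infinite_if_separates_singletons:
  assumes "S \<subseteq> topspace K" "infinite N"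
    and "\<And>m n. m \<in> N \<Longrightarrow> n \<in> N \<Longrightarrow> m \<noteq> n \<Longrightarrow> \<exists>x\<in>S. \<bar>f {m} x - f {n} x\<bar> \<ge> gap 1"
  shows "infinite S"
proof (rule infinite_if_separates_bounded[where h = "\<lambda>n. f {n}" and B = "\<lambda>x. \<bar>f {} x\<bar> + a"])
  fix n x assume "x \<in> S"
  then have "\<bar>f {n} x - f {} x\<bar> \<le> a"
    using abs_diff_le[of "{n}" "{}" x 1] assms(1) k_pos by (auto simp: Delta_points_def)
  then show "\<bar>f {n} x\<bar> \<le> \<bar>f {} x\<bar> + a"
    by linarith
qed (use assms gap_1_pos in auto)

text \<open>Shrinking each set to a singleton costs at most \<open>(j - 1) * a\<close>, and the two
  costs add up to \<open>gap j - gap 1\<close>.\<close>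

lemma singletons_separated:
  assumes "finite \<sigma>" "finite \<tau>" "card \<sigma> = j" "card \<tau> = j" "1 \<le> j" "j \<le> k"
    and "m \<in> \<sigma>" "n \<in> \<tau>" "x \<in> far \<sigma> \<tau>"
  shows "\<bar>f {m} x - f {n} x\<bar> \<ge> gap 1"
proof -
  have pts: "\<sigma> \<in> Delta_points k" "\<tau> \<in> Delta_points k" "{m} \<in> Delta_points k" "{n} \<in> Delta_points k"
    using assms by (auto simp: Delta_points_def)
  have "sym_diff \<sigma> {m} = \<sigma> - {m}" "sym_diff \<tau> {n} = \<tau> - {n}"
    using assms by auto
  then have "card (sym_diff \<sigma> {m}) \<le> j - 1" "card (sym_diff \<tau> {n}) \<le> j - 1"
    using assms by simp_all
  then have "\<bar>f \<sigma> x - f {m} x\<bar> \<le> real (j - 1) * a" "\<bar>f \<tau> x - f {n} x\<bar> \<le> real (j - 1) * a"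
    using assms pts by (blast intro: abs_diff_le far_subset[THEN subsetD])+
  moreover have "gap j \<le> \<bar>f \<sigma> x - f \<tau> x\<bar>"
    using assms by (simp add: far_def)
  moreover have "gap j = gap 1 + 2 * (real (j - 1) * a)"
    using \<open>1 \<le> j\<close> by (simp add: gap_def of_nat_diff algebra_simps)
  ultimately show ?thesis
    by linarith
qed

lemma cantor_bendixson_meets_far:
  assumes "finite \<sigma>" "finite \<tau>" "\<sigma> \<inter> \<tau> = {}" "card \<sigma> = k - i" "card \<tau> = k - i" "i < k"
  shows "cantor_bendixson K i \<inter> far \<sigma> \<tau> \<noteq> {}"
  using assms
proof (induction i arbitrary: \<sigma> \<tau>)
  case 0
  have pts: "\<sigma> \<in> Delta_points k" "\<tau> \<in> Delta_points k"
    using 0 by (auto simp: Delta_points_def)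
  have "sym_diff \<sigma> \<tau> = \<sigma> \<union> \<tau>"
    using 0 by blast
  then have "Delta_dist \<sigma> \<tau> = 2 * real k"
    using 0 by (simp add: Delta_dist_def card_Un_disjoint)
  then have *: "2 * real k / b \<le> mdist (C_space K) (f \<sigma>) (f \<tau>)"
    using lower[OF pts] b_pos by (simp add: pos_divide_le_eq mult.commute)
  moreover have "2 * real k / b > 0"
    using k_pos b_pos by simp
  ultimately obtain x where
    "x \<in> topspace K" "mdist (C_space K) (f \<sigma>) (f \<tau>) \<le> \<bar>f \<sigma> x - f \<tau> x\<bar>"
    using mdist_C_space_attained[OF compact, of "f \<sigma>" "f \<tau>"] maps pts
    by (metis PiE less_le_trans)
  then show ?case
    using * 0 by (auto simp: far_def gap_def)
next
  case (Suc i)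
  have pts: "\<sigma> \<in> Delta_points k" "\<tau> \<in> Delta_points k"
    using Suc.prems by (auto simp: Delta_points_def)
  \<comment> \<open>Distinct elements from here keep the enlarged sets disjoint, as the induction
    hypothesis requires.\<close>
  let ?N = "- (\<sigma> \<union> \<tau>)"
  have "infinite ?N"
    using Suc.prems by (meson finite_Un finite_compl infinite_UNIV_nat)
  moreover have "\<exists>x \<in> cantor_bendixson K i \<inter> far \<sigma> \<tau>. \<bar>f {m} x - f {n} x\<bar> \<ge> gap 1"
    if mn: "m \<in> ?N" "n \<in> ?N" "m \<noteq> n" for m n
  proof -
    have card: "card (insert m \<sigma>) = k - i" "card (insert n \<tau>) = k - i"
      using Suc.prems mn by auto
    moreover have "insert m \<sigma> \<inter> insert n \<tau> = {}"
      using Suc.prems mn by auto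
    ultimately obtain x where x: "x \<in> cantor_bendixson K i" "x \<in> far (insert m \<sigma>) (insert n \<tau>)"
      using Suc.IH[of "insert m \<sigma>" "insert n \<tau>"] Suc.prems by auto
    have "sym_diff (insert m \<sigma>) \<sigma> = {m}" "sym_diff (insert n \<tau>) \<tau> = {n}"
      using mn by auto
    \<comment> \<open>Undoing both insertions loses at most \<open>2 * a\<close>, the difference of
      consecutive gaps, so \<open>x\<close> remains in \<open>far \<sigma> \<tau>\<close>.\<close>
    then have "\<bar>f (insert m \<sigma>) x - f \<sigma> x\<bar> \<le> a" "\<bar>f (insert n \<tau>) x - f \<tau> x\<bar> \<le> a"
      using abs_diff_le[of "insert m \<sigma>" \<sigma> x 1] abs_diff_le[of "insert n \<tau>" \<tau> x 1]
        x(2) pts card Suc.prems by (auto simp: far_def Delta_points_def)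
    moreover have "gap (k - i) = gap (k - Suc i) + 2 * a"
      using gap_Suc[of "k - Suc i"] Suc.prems by (simp add: Suc_diff_Suc)
    moreover have "gap (k - i) \<le> \<bar>f (insert m \<sigma>) x - f (insert n \<tau>) x\<bar>"
      using x(2) card by (simp add: far_def)
    ultimately have "gap (k - Suc i) \<le> \<bar>f \<sigma> x - f \<tau> x\<bar>"
      by linarith
    then have "x \<in> far \<sigma> \<tau>"
      using x(2) Suc.prems by (simp add: far_def)
    moreover have "\<bar>f {m} x - f {n} x\<bar> \<ge> gap 1"
      using singletons_separated[OF _ _ card _ _ _ _ x(2)] Suc.prems by auto
    ultimately show ?thesis
      using x(1) by blast
  qed
  ultimately have "infinite (cantor_bendixson K i \<inter> far \<sigma> \<tau>)"
    by (intro infinite_if_separates_singletons[of _ ?N]) (auto simp: far_def)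
  then show ?case
    using cantor_bendixson_Suc_meets_infinite[OF compact closedin_far[OF pts]] by blast
qed

lemma infinite_cantor_bendixson: "infinite (cantor_bendixson K (k - 1))"
\<comment> \<open>At order \<open>k - 1\<close> the sets are singletons, so the points found
  separate all the \<open>f {n}\<close> directly.\<close>
proof (rule infinite_if_separates_singletons[of _ UNIV])
  show "cantor_bendixson K (k - 1) \<subseteq> topspace K"
    by (rule closedin_subset[OF closedin_cantor_bendixson])
  fix m n :: nat assume "m \<noteq> n"
  then obtain x where "x \<in> cantor_bendixson K (k - 1)" "x \<in> far {m} {n}"
    using cantor_bendixson_meets_far[of "{m}" "{n}" "k - 1"] k_pos by auto
  then show "\<exists>x \<in> cantor_bendixson K (k - 1). \<bar>f {m} x - f {n} x\<bar> \<ge> gap 1"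
    by (auto simp: far_def)
qed simp

end

theorem theorem2p2:
  fixes K :: "'a topology" and k :: nat
  assumes "compact_space K"
    and "k \<ge> 2"
    and "\<exists>f. bi_lipschitz_embedding (Delta k) (C_space K) f \<and>
             distortion (Delta k) (C_space K) f < ennreal (real k / (real k - 1))"
  shows "infinite (cantor_bendixson K (k - 1))"
proof -
  obtain f where f: "f \<in> Delta_points k \<rightarrow> mspace (C_space K)"
    "distortion (Delta k) (C_space K) f < ennreal (real k / (real k - 1))"
    using assms(3) by (auto simp: bi_lipschitz_embedding_def)
  \<comment> \<open>Two distinct points, to make both suprema in the distortion positive.\<close>
  have "{} \<in> Delta_points k" "{0} \<in> Delta_points k"
    using assms(2) by (auto simp: Delta_points_def)
  then obtain a b where ab: "a > 0" "b > 0" "a * b < real k / (real k - 1)"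
    and bounds:
      "\<And>\<sigma> \<tau>. \<sigma> \<in> Delta_points k \<Longrightarrow> \<tau> \<in> Delta_points k \<Longrightarrow>
        mdist (C_space K) (f \<sigma>) (f \<tau>) \<le> a * Delta_dist \<sigma> \<tau>"
      "\<And>\<sigma> \<tau>. \<sigma> \<in> Delta_points k \<Longrightarrow> \<tau> \<in> Delta_points k \<Longrightarrow>
        Delta_dist \<sigma> \<tau> \<le> b * mdist (C_space K) (f \<sigma>) (f \<tau>)"
    using distortion_less_imp_bounds[OF f(2), of "{}" "{0}"] f(1) by auto
  have "real (k - 1) * (a * b) < real k"
    using ab(3) assms(2) by (simp add: pos_less_divide_eq of_nat_diff mult.commute)
  then interpret low_distortion_embedding K k f a b
    using assms f(1) ab bounds by unfold_locales auto
  show ?thesis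
    by (rule infinite_cantor_bendixson)
qed

end
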